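(* For every $n,k\in\mathbb N$ with $n\ge k$, $$ex_<(n,\neg\text{Sep-}\mathcal M_k)= \left\lceil\frac{n-2k+1}{k}\right\rceil\left(\binom{2k-1}{2}-\binom{k-1}{2}\right)+\binom{2k-1-\{n+1\}_k}{2},$$ where $\{N\}_k$ denotes the residue of $N$ upon division by $k$.
   Context: An ordered graph on $n$ vertices is a graph with vertex set $[n]=\{1,\dots,n\}$ with its natural linear order. An ordered graph $G$ contains a copy of an ordered graph $H$ if there is an injective, order-preserving map $V(H)\to V(G)$ sending edges to edges. For a family $\mathcal H$ of ordered graphs, $ex_<(n,\mathcal H)$ is the maximum number of edges of an ordered graph on vertex set $[n]$ containing no copy of any member of $\mathcal H$. Two vertex-disjoint edges $xy$, $uv$ with $x<y$, $u<v$ are separated if the integer intervals $[x,y]$ and $[u,v]$ are disjoint; nested if one of these intervals contains the other; crossing otherwise. A $k$-matching is a set of $k$ pairwise vertex-disjoint edges. $\neg\text{Sep-}\mathcal M_k$ denotes the family of non-separated $k$-matchings, i.e. $k$-matchings (on integer vertices) in which no pair of edges is separated (every pair is nested or crossing).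
   Formalization: The last binomial uses the residue of −(n+1) modulo k instead of {n+1}_k, since the printed formula is false (for n=k=3 it gives 6 edges on 3 vertices); k≥1 is assumed so that the division and the residue make sense. *)

theory Defs
  imports Complex_Main
begin

type_synonym 'a ograph = "'a set \<times> 'a set set"

definition ordered_graph :: "'a::linorder ograph \<Rightarrow> bool" where
  "ordered_graph G \<longleftrightarrow> finite (fst G) \<and> (\<forall>e\<in>snd G. e \<subseteq> fst G \<and> card e = 2)"

definition contains_copy :: "'b::linorder ograph \<Rightarrow> 'a::linorder ograph \<Rightarrow> bool" where
  "contains_copy G H \<longleftrightarrow>
     (\<exists>f. f ` fst H \<subseteq> fst G \<and> strict_mono_on (fst H) f \<and> (\<forall>e\<in>snd H. f ` e \<in> snd G))"

text \<open>The maximum is over a nonempty set whenever every member of the family has an edge,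
  since then the edgeless graph qualifies.\<close>

definition ex_ord :: "nat \<Rightarrow> 'a::linorder ograph set \<Rightarrow> nat" where
  "ex_ord n \<H> = Max {card E | E :: nat set set.
     ordered_graph ({1..n}, E) \<and> (\<forall>H\<in>\<H>. \<not> contains_copy ({1..n}, E) H)}"

definition separated :: "'a::linorder set \<Rightarrow> 'a set \<Rightarrow> bool" where
  "separated e e' \<longleftrightarrow> {Min e..Max e} \<inter> {Min e'..Max e'} = {}"

definition k_matching :: "nat \<Rightarrow> 'a set set \<Rightarrow> bool" where
  "k_matching k M \<longleftrightarrow> finite M \<and> card M = k \<and> (\<forall>e\<in>M. card e = 2) \<and> pairwise disjnt M"

text \<open>A matching is regarded as an ordered graph without isolated vertices.\<close>

definition non_sep_matchings :: "nat \<Rightarrow> int ograph set" where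
  "non_sep_matchings k =
     {(\<Union>M, M) | M. k_matching k M \<and> pairwise (\<lambda>e e'. \<not> separated e e') M}"

text \<open>Sign of the residue in the extremal formula. The extremal number is expressed below with the
  residue of \<open>-(n + 1)\<close> modulo \<open>k\<close>, that is the \<open>r \<in> {0..<k}\<close> with
  \<open>n - 2k + 1 = k \<lceil>(n - 2k + 1) / k\<rceil> - r\<close>. The formula is also found in print with the residue of
  \<open>n + 1\<close> itself; that version agrees for \<open>k \<le> 2\<close> but is false in general: for
  \<open>n = k = 3\<close> it gives 6, whereas a graph on 3 vertices has at most 3 edges.\<close>

end

theory Submission
  imports Defs
begin

text \<open>
  Pairwise non-separated disjoint edges all cross a common gap between \<open>p\<close> and \<open>p + 1\<close>, so the
  forbidden configuration is a \<open>k\<close>-matching in one of the bipartite graphs \<open>G\<^sub>p\<close> of edges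
  crossing a gap. By Koenig's theorem each \<open>G\<^sub>p\<close> has a vertex cover of size less than \<open>k\<close>; a minimum
  cover corresponds to a set \<open>S\<^sub>p\<close> of right vertices minimising \<open>|N\<^sub>p(S)| - |S|\<close>, the cover being
  \<open>N\<^sub>p(S\<^sub>p)\<close> together with the right vertices outside \<open>S\<^sub>p\<close>. Submodularity allows the choice
  \<open>S\<^sub>p\<^sub>+\<^sub>1 \<subseteq> S\<^sub>p\<close>, and then the edges are counted by induction on \<open>p\<close> as their right ends leave \<open>S\<^sub>p\<close>.
  Equality holds for the graph in which \<open>j\<close> is joined to all \<open>i < j\<close> with
  \<open>i > k (\<lfloor>j / k\<rfloor> - 1)\<close>: the edges crossing a gap are covered by the \<open>k - 1\<close> vertices
  strictly between the two multiples of \<open>k\<close> surrounding it.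
\<close>

section \<open>Koenig's theorem for bipartite edge sets\<close>

text \<open>If \<open>(a, b)\<close> and \<open>(a, c)\<close> share \<open>a\<close>, the small
  covers of the two deletions miss \<open>a\<close>, hence contain \<open>c\<close> and
  \<open>b\<close> respectively. Intersecting them on one side and uniting on the other gives two
  covers of \<open>E\<close>, one with \<open>a\<close> added, of total size at most
  \<open>2(k - 1) + 1 < 2k\<close>.\<close>

lemma inj_on_fst_if_cover_critical:
  fixes E :: "('a \<times> 'b) set"
  assumes ge: "\<And>X Y. finite X \<Longrightarrow> finite Y \<Longrightarrow> E \<subseteq> X \<times> UNIV \<union> UNIV \<times> Y \<Longrightarrow> k \<le> card X + card Y"
    and crit: "\<And>e. e \<in> E \<Longrightarrow> \<exists>X Y. finite X \<and> finite Y \<and>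
      E - {e} \<subseteq> X \<times> UNIV \<union> UNIV \<times> Y \<and> card X + card Y < k"
  shows "inj_on fst E"
proof (rule inj_onI, rule ccontr)
  fix e f assume e: "e \<in> E" and f: "f \<in> E" and same: "fst e = fst f" and "e \<noteq> f"
  obtain a b c where [simp]: "e = (a, b)" "f = (a, c)"
    using same by (metis prod.collapse)
  have "b \<noteq> c" using \<open>e \<noteq> f\<close> by auto
  obtain X1 Y1 where 1: "finite X1" "finite Y1" "E - {e} \<subseteq> X1 \<times> UNIV \<union> UNIV \<times> Y1"
    "card X1 + card Y1 < k" using crit[OF e] by blast
  obtain X2 Y2 where 2: "finite X2" "finite Y2" "E - {f} \<subseteq> X2 \<times> UNIV \<union> UNIV \<times> Y2"
    "card X2 + card Y2 < k" using crit[OF f] by blast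
  have "\<not> E \<subseteq> X1 \<times> UNIV \<union> UNIV \<times> Y1" "\<not> E \<subseteq> X2 \<times> UNIV \<union> UNIV \<times> Y2"
    using ge 1 2 by (meson not_le)+
  then have "a \<notin> X1" "a \<notin> X2" using 1(3) 2(3) by auto
  then have "c \<in> Y1" "b \<in> Y2" using 1(3) 2(3) e f \<open>b \<noteq> c\<close> by auto
  have "E \<subseteq> (X1 \<inter> X2) \<times> UNIV \<union> UNIV \<times> (Y1 \<union> Y2)"
    using 1(3) 2(3) \<open>c \<in> Y1\<close> \<open>b \<in> Y2\<close> by auto
  from ge[OF _ _ this] have A: "k \<le> card (X1 \<inter> X2) + card (Y1 \<union> Y2)" using 1 2 by simp
  have "E \<subseteq> insert a (X1 \<union> X2) \<times> UNIV \<union> UNIV \<times> (Y1 \<inter> Y2)"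
    using 1(3) 2(3) by auto
  from ge[OF _ _ this] have B: "k \<le> Suc (card (X1 \<union> X2)) + card (Y1 \<inter> Y2)"
    using 1 2 \<open>a \<notin> X1\<close> \<open>a \<notin> X2\<close> by simp
  show False
    using A B 1 2 card_Un_Int[of X1 X2] card_Un_Int[of Y1 Y2] by linarith
qed


text \<open>Koenig's theorem, after Lovasz: in an edge set that is minimal with vertex covering number
  at least \<open>k\<close>, no two edges meet, because covers of the two one-edge deletions could be uncrossed.\<close>

theorem konig_matching_if_covers_large:
  fixes E :: "('a \<times> 'b) set"
  assumes "finite E"
    and "\<And>X Y. finite X \<Longrightarrow> finite Y \<Longrightarrow> E \<subseteq> X \<times> UNIV \<union> UNIV \<times> Y \<Longrightarrow> k \<le> card X + card Y"
  shows "\<exists>M\<subseteq>E. card M = k \<and> inj_on fst M \<and> inj_on snd M"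
  using assms
proof (induction E rule: finite_psubset_induct)
  case (psubset E)
  show ?case
  proof (cases "\<exists>e\<in>E. \<forall>X Y. finite X \<longrightarrow> finite Y \<longrightarrow> E - {e} \<subseteq> X \<times> UNIV \<union> UNIV \<times> Y
      \<longrightarrow> k \<le> card X + card Y")
    case True
    then obtain e where e: "e \<in> E" and
      c: "\<And>X Y. finite X \<Longrightarrow> finite Y \<Longrightarrow> E - {e} \<subseteq> X \<times> UNIV \<union> UNIV \<times> Y \<Longrightarrow> k \<le> card X + card Y"
      by blast
    have "E - {e} \<subset> E" using e by blast
    from psubset.IH[OF this c] show ?thesis by blast
  next
    case False
    then have crit: "\<exists>X Y. finite X \<and> finite Y \<and>
      E - {e} \<subseteq> X \<times> UNIV \<union> UNIV \<times> Y \<and> card X + card Y < k" if "e \<in> E" for e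
      using that by (meson not_le)
    have fst: "inj_on fst E"
      using inj_on_fst_if_cover_critical[OF psubset.prems crit] by blast
    have "inj_on fst (E\<inverse>)"
    proof (rule inj_on_fst_if_cover_critical)
      fix X Y assume "finite X" "finite Y" "E\<inverse> \<subseteq> X \<times> UNIV \<union> UNIV \<times> Y"
      moreover from this have "E \<subseteq> Y \<times> UNIV \<union> UNIV \<times> X" by auto
      ultimately show "k \<le> card X + card Y" using psubset.prems[of Y X] by (simp add: add.commute)
    next
      fix e assume "e \<in> E\<inverse>"
      then obtain X Y where "finite X" "finite Y" "E - {(snd e, fst e)} \<subseteq> X \<times> UNIV \<union> UNIV \<times> Y"
        "card X + card Y < k" using crit[of "(snd e, fst e)"] by auto
      then show "\<exists>X Y. finite X \<and> finite Y \<and> E\<inverse> - {e} \<subseteq> X \<times> UNIV \<union> UNIV \<times> Y \<and> card X + card Y < k"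
        by (intro exI[of _ Y] exI[of _ X]) auto
    qed
    then have snd: "inj_on snd E" by (simp add: inj_on_def Ball_def)
    \<comment> \<open>The left ends are distinct, so the cover by all of them has size
      \<open>card E\<close>; any \<open>k\<close> edges then form the matching.\<close>
    have "k \<le> card (fst ` E) + card ({} :: 'b set)"
    proof (rule psubset.prems)
      show "E \<subseteq> fst ` E \<times> UNIV \<union> UNIV \<times> {}" by force
    qed (use psubset.hyps in auto)
    then have "k \<le> card E" using card_image[OF fst] by simp
    then obtain M where "M \<subseteq> E" "card M = k" by (meson obtain_subset_with_card_n)
    then show ?thesis using inj_on_subset[OF fst] inj_on_subset[OF snd] by blast
  qed
qed

section \<open>Arithmetic of the extremal edge count\<close>

lemma sum_lessThan_card_le:
  fixes A :: "nat set"
  assumes "finite A"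
  shows "\<Sum>{..<card A} \<le> \<Sum>A"
  using assms
proof (induction A rule: finite_linorder_max_induct)
  case (insert b A)
  have "A \<subseteq> {..<b}" using insert by auto
  then have "card A \<le> b" by (metis card_mono card_lessThan finite_lessThan)
  then show ?case using insert by (auto simp: add.commute lessThan_Suc)
qed simp

lemma sum_lessThan_eq_choose_two: "\<Sum>{..<d} = (d choose 2)" for d :: nat
  by (induction d) (auto simp: numeral_2_eq_2)

text \<open>The number of smaller neighbours of the vertex \<open>m + 1\<close> in the extremal graph.\<close>

definition extremal_degree :: "nat \<Rightarrow> nat \<Rightarrow> nat" where
  "extremal_degree k m = (if m < k - 1 then m else k - 1 + (m + 1) mod k)"

definition extremal_count :: "nat \<Rightarrow> nat \<Rightarrow> nat" where
  "extremal_count k n = (\<Sum>m<n. extremal_degree k m)"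

text \<open>In this range the remainder in the second branch is \<open>m + 1 - k\<close>: the
  extremal graph is complete up to vertex \<open>2k - 1\<close>.\<close>

lemma extremal_degree_small:
  assumes "m + 2 \<le> 2 * k"
  shows "extremal_degree k m = m"
proof (cases "m < k - 1")
  case False
  then have "(m + 1) mod k = m + 1 - k" using assms
    by (subst le_mod_geq) auto
  then show ?thesis using False assms by (auto simp: extremal_degree_def)
qed (auto simp: extremal_degree_def)

lemma extremal_count_small:
  assumes "n + 1 \<le> 2 * k"
  shows "extremal_count k n = (n choose 2)"
proof -
  have "extremal_count k n = \<Sum>{..<n}"
    unfolding extremal_count_def by (rule sum.cong) (use assms in \<open>auto simp: extremal_degree_small\<close>)
  then show ?thesis by (simp add: sum_lessThan_eq_choose_two)
qed

lemma extremal_count_add: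
  "extremal_count k (q + d) = extremal_count k q + (\<Sum>m=q..<q + d. extremal_degree k m)"
  unfolding extremal_count_def lessThan_atLeast0
  by (rule sum.atLeastLessThan_concat[symmetric]) auto

lemma mod_inj_on_window:
  fixes q d k :: nat
  assumes "d \<le> k"
  shows "inj_on (\<lambda>m. (m + 1) mod k) {q..<q + d}"
proof -
  have *: False if "(x + 1) mod k = (y + 1) mod k" "q \<le> x" "x < y" "y < q + d" for x y
  proof -
    have "k dvd (y + 1) - (x + 1)" using that by (metis mod_eq_dvd_iff_nat add_le_mono1 less_imp_le_nat)
    then have "k \<le> y - x" using that by (auto dest: dvd_imp_le)
    then show False using that assms by linarith
  qed
  show ?thesis by (rule inj_onI) (metis * atLeastLessThan_iff linorder_neqE_nat)
qed

text \<open>This growth pays for \<open>d\<close> vertices that form a clique and have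
  \<open>c\<close> further neighbours each. In an early window the degrees are
  \<open>q, q + 1, ...\<close>; otherwise each is \<open>k - 1 \<ge> c\<close> plus a remainder, and
  at most \<open>k\<close> consecutive remainders are distinct.\<close>

lemma extremal_count_increment:
  assumes "d \<le> k" "c \<le> q" "c \<le> k - 1"
  shows "d * c + (d choose 2) \<le> (\<Sum>m=q..<q + d. extremal_degree k m)"
proof (cases "q < k - 1")
  case True
  have "(\<Sum>m=q..<q + d. extremal_degree k m) = (\<Sum>m=q..<q + d. m)"
    by (rule sum.cong) (use True assms in \<open>auto intro!: extremal_degree_small\<close>)
  also have "\<dots> = (\<Sum>m<d. m + q)"
    using sum.shift_bounds_nat_ivl[of "\<lambda>m. m" 0 q d] by (simp add: lessThan_atLeast0 add.commute)
  also have "\<dots> = d * q + (d choose 2)"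
    by (simp add: sum.distrib sum_lessThan_eq_choose_two)
  finally show ?thesis using assms by simp
next
  case False
  have "(\<Sum>m=q..<q + d. extremal_degree k m) = (\<Sum>m=q..<q + d. k - 1 + (m + 1) mod k)"
    by (rule sum.cong) (use False in \<open>auto simp: extremal_degree_def\<close>)
  also have "\<dots> = d * (k - 1) + (\<Sum>m=q..<q + d. (m + 1) mod k)"
    by (simp only: sum.distrib sum_constant card_atLeastLessThan diff_add_inverse of_nat_id)
  also have "(\<Sum>m=q..<q + d. (m + 1) mod k) = \<Sum>((\<lambda>m. (m + 1) mod k) ` {q..<q + d})"
    by (simp only: sum.reindex[OF mod_inj_on_window[OF assms(1)]] comp_def)
  finally show ?thesis
    using sum_lessThan_card_le[of "(\<lambda>m. (m + 1) mod k) ` {q..<q + d}"] assms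
    unfolding card_image[OF mod_inj_on_window[OF assms(1)]] sum_lessThan_eq_choose_two
    by (simp add: add_mono)
qed

text \<open>The remainders in the window run once through all residues modulo
  \<open>k\<close>.\<close>

lemma extremal_count_period:
  assumes "1 \<le> k" "k - 1 \<le> q"
  shows "extremal_count k (q + k) = extremal_count k q + k * (k - 1) + (k choose 2)"
proof -
  have img: "(\<lambda>m. (m + 1) mod k) ` {q..<q + k} = {..<k}"
    by (rule card_subset_eq) (use assms in \<open>auto simp only: card_image[OF mod_inj_on_window[OF order_refl]] finite_lessThan card_lessThan card_atLeastLessThan, auto\<close>)
  have "(\<Sum>m=q..<q + k. extremal_degree k m) = (\<Sum>m=q..<q + k. k - 1 + (m + 1) mod k)"
    by (rule sum.cong) (use assms in \<open>auto simp: extremal_degree_def\<close>)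
  also have "\<dots> = k * (k - 1) + (\<Sum>m=q..<q + k. (m + 1) mod k)"
    by (simp only: sum.distrib sum_constant card_atLeastLessThan diff_add_inverse of_nat_id)
  also have "(\<Sum>m=q..<q + k. (m + 1) mod k) = \<Sum>((\<lambda>m. (m + 1) mod k) ` {q..<q + k})"
    by (simp only: sum.reindex[OF mod_inj_on_window[OF order_refl]] comp_def)
  finally show ?thesis by (simp only: img extremal_count_add sum_lessThan_eq_choose_two)
qed

lemma choose_two_add: "(m + d choose 2) = (m choose 2) + d * m + (d choose 2)"
  by (induction d) (auto simp: numeral_2_eq_2)

text \<open>Identifies the coefficient in the closed formula with the growth over one
  period.\<close>

lemma choose_two_diff:
  assumes "1 \<le> k"
  shows "int ((2 * k - 1) choose 2) - int ((k - 1) choose 2) = int (k * (k - 1) + (k choose 2))"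
proof -
  have "2 * k - 1 = (k - 1) + k" using assms by simp
  then have "(2 * k - 1 choose 2) = (k - 1 choose 2) + k * (k - 1) + (k choose 2)"
    using choose_two_add[of "k - 1" k] by (simp only:)
  then show ?thesis by simp
qed

text \<open>Removing \<open>q\<close> full periods from \<open>n\<close> leaves
  \<open>2k - 1 - r\<close> vertices, where the graph is complete.\<close>

lemma extremal_count_closed_form:
  assumes "1 \<le> k" "k \<le> n"
  shows "int (extremal_count k n) =
    \<lceil>(real n - 2 * real k + 1) / real k\<rceil>
        * (int ((2 * k - 1) choose 2) - int ((k - 1) choose 2))
      + int ((2 * k - 1 - nat ((- (int n + 1)) mod int k)) choose 2)"
proof -
  define r where "r = nat ((- (int n + 1)) mod int k)"
  have r: "int r = (- (int n + 1)) mod int k" "r < k"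
    using assms by (auto simp: r_def nat_less_iff)
  have "\<exists>q::nat. n + 1 + r = q * k"
  proof -
    have "(int n + 1 + int r) mod int k = 0" unfolding r(1) by (simp add: mod_simps)
    then have "int k dvd int (n + 1 + r)" by (simp add: dvd_eq_mod_eq_0 algebra_simps)
    then show ?thesis by (metis dvd_def int_dvd_int_iff mult.commute)
  qed
  then obtain q' where q': "n + 1 + r = q' * k" by blast
  \<comment> \<open>Here \<open>n \<ge> k\<close> enters: it forces \<open>q' \<ge> 2\<close>. With
    \<open>q = q' - 2\<close> one has \<open>n - 2k + 1 = qk - r\<close> and
    \<open>0 \<le> r < k\<close>, so the ceiling is \<open>q\<close>.\<close>
  have "k * 1 < k * q'" using q' assms by (metis Suc_eq_plus1 add_Suc le_add1 le_imp_less_Suc le_trans mult.commute mult.right_neutral)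
  then have "2 \<le> q'" using nat_mult_less_cancel_disj by fastforce
  then obtain q where q: "q' = q + 2" by (metis add.commute le_Suc_ex)
  have n: "n = (2 * k - 1 - r) + q * k"
    using q' q r(2) assms by (simp add: algebra_simps)
  have "extremal_count k ((2 * k - 1 - r) + s * k) =
      s * (k * (k - 1) + (k choose 2)) + ((2 * k - 1 - r) choose 2)" for s
  proof (induction s)
    case 0
    have "2 * k - 1 - r + 1 \<le> 2 * k" using assms by simp
    then show ?case by (simp only: extremal_count_small mult_0 add_0 add_0_right)
  next
    case (Suc s)
    have "extremal_count k ((2 * k - 1 - r) + s * k + k) = 
      extremal_count k ((2 * k - 1 - r) + s * k) + k * (k - 1) + (k choose 2)"
      by (rule extremal_count_period) (use assms r(2) in auto)
    moreover have "2 * k - 1 - r + Suc s * k = 2 * k - 1 - r + s * k + k" by simp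
    ultimately show ?case unfolding Suc.IH by (simp only: mult_Suc ac_simps)
  qed
  from this[of q] have "extremal_count k n = q * (k * (k - 1) + (k choose 2)) + ((2 * k - 1 - r) choose 2)"
    using n by simp
  moreover have "\<lceil>(real n - 2 * real k + 1) / real k\<rceil> = int q"
  proof (rule ceiling_unique)
    have e: "real n - 2 * real k + 1 = real q * real k - real r"
      using arg_cong[OF q', of real] q by (simp add: algebra_simps)
    show "(real n - 2 * real k + 1) / real k \<le> real_of_int (int q)"
      unfolding e using assms by (simp add: field_simps)
    show "real_of_int (int q) - 1 < (real n - 2 * real k + 1) / real k"
      unfolding e using assms r(2) by (simp add: field_simps)
  qed
  ultimately show ?thesis
    unfolding choose_two_diff[OF assms(1)] r_def[symmetric] by simp
qed

section \<open>Upper bound by sweeping the gap from left to right\<close>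

lemma card_le_extremal_count_if_crossing_covers:
  fixes E :: "(nat \<times> nat) set"
  assumes E: "E \<subseteq> {(i, j). 1 \<le> i \<and> i < j \<and> j \<le> n}"
    and cover: "\<And>p. p \<le> n \<Longrightarrow> \<exists>X Y. finite X \<and> finite Y \<and>
      {(i, j) \<in> E. i \<le> p \<and> p < j} \<subseteq> X \<times> UNIV \<union> UNIV \<times> Y \<and> card X + card Y < k"
  shows "card E \<le> extremal_count k n"
proof -
  define N where "N p S = {i. i \<le> p \<and> (\<exists>j\<in>S. (i, j) \<in> E)}" for p S
  \<comment> \<open>For \<open>S\<close> inside \<open>{p<..n}\<close>, adding \<open>n - p\<close>
    gives the size of the cover formed by \<open>N p S\<close> and the right vertices outside
    \<open>S\<close>.\<close>
  define excess where "excess p S = int (card (N p S)) - int (card S)" for p S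
  define minimiser where "minimiser p S \<longleftrightarrow> S \<subseteq> {p<..n} \<and> (\<forall>T. T \<subseteq> {p<..n} \<longrightarrow> excess p S \<le> excess p T)"
    for p S
  \<comment> \<open>The edges counted so far. At \<open>p = n\<close> a minimiser is empty and all
    edges are counted.\<close>
  define G where "G p S = {e \<in> E. fst e \<le> p \<and> snd e \<notin> S}" for p S
  have finE: "finite E" by (rule finite_subset[of _ "{..n} \<times> {..n}"]) (use E in auto)
  have N_sub: "N p S \<subseteq> {1..p}" for p S using E by (auto simp: N_def)
  have finN: "finite (N p S)" and cardN: "card (N p S) \<le> p" for p S
    using N_sub[of p S] card_mono[OF _ N_sub[of p S]] finite_subset by auto
  have ex_min: "\<exists>S. minimiser p S" for p
  proof -
    let ?A = "excess p ` Pow {p<..n}"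
    have "Min ?A \<in> ?A" by (rule Min_in) auto
    then obtain S where "S \<subseteq> {p<..n}" "excess p S = Min ?A" by auto
    then show ?thesis unfolding minimiser_def by (intro exI[of _ S]) auto
  qed
  \<comment> \<open>The right vertices outside \<open>Y\<close> have all their left neighbours in
    \<open>X\<close>, so the cover given by a minimiser is no larger than the assumed one.\<close>
  have min_less: "card (N p S) + (n - p - card S) < k" if "p \<le> n" "minimiser p S" for p S
  proof -
    obtain X Y where XY: "finite X" "finite Y" "card X + card Y < k"
      "{(i, j) \<in> E. i \<le> p \<and> p < j} \<subseteq> X \<times> UNIV \<union> UNIV \<times> Y"
      using cover[OF \<open>p \<le> n\<close>] by blast
    let ?T = "{p<..n} - Y"
    have "N p ?T \<subseteq> X" using XY(4) by (auto simp: N_def)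
    then have "card (N p ?T) \<le> card X" using XY(1) card_mono by blast
    moreover have "n - p - card Y \<le> card ?T"
      using diff_card_le_card_Diff[of Y "{p<..n}"] XY(2) by simp
    moreover have "excess p S \<le> excess p ?T" using that(2) by (auto simp: minimiser_def)
    moreover have "card S \<le> n - p"
      using that(2) card_mono[of "{p<..n}" S] by (auto simp: minimiser_def)
    ultimately show ?thesis using XY(3) \<open>p \<le> n\<close> unfolding excess_def by linarith
  qed
  \<comment> \<open>Uncrossing: submodularity of the neighbourhood sizes holds even across the two
    gaps \<open>p\<close> and \<open>Suc p\<close>. As \<open>T \<union> S\<close> is a candidate at
    \<open>p\<close>, it cannot beat \<open>S\<close>, so \<open>T \<inter> S\<close> is no worse
    than \<open>T\<close>.\<close>
  have min_Int: "minimiser (Suc p) (T \<inter> S)" if S: "minimiser p S" and T: "minimiser (Suc p) T" for p S T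
  proof -
    let ?A = "N (Suc p) (T \<inter> S)" and ?B = "N p (T \<union> S)" and ?C = "N (Suc p) T" and ?D = "N p S"
    have "card (?A \<union> ?B) \<le> card (?C \<union> ?D)" "card (?A \<inter> ?B) \<le> card (?C \<inter> ?D)"
      by (rule card_mono; use finN in \<open>auto simp: N_def\<close>)+
    then have 1: "card ?A + card ?B \<le> card ?C + card ?D"
      using card_Un_Int[of ?A ?B] card_Un_Int[of ?C ?D] finN by simp
    have sub: "T \<subseteq> {Suc p<..n}" "S \<subseteq> {p<..n}" using S T by (auto simp: minimiser_def)
    then have "finite T" "finite S" using finite_subset by blast+
    then have 2: "card T + card S = card (T \<union> S) + card (T \<inter> S)" by (rule card_Un_Int)
    have "T \<union> S \<subseteq> {p<..n}" using sub by auto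
    then have 3: "excess p S \<le> excess p (T \<union> S)" using S by (auto simp: minimiser_def)
    have "excess (Suc p) (T \<inter> S) \<le> excess (Suc p) T"
      using 1 2 3 unfolding excess_def by linarith
    then show ?thesis using T sub unfolding minimiser_def by (meson inf.coboundedI1 order_trans)
  qed
  \<comment> \<open>The second summand pays in advance for the edges among the \<open>w = n - p - card S\<close> right vertices
    outside \<open>S\<close>, as if these vertices formed a clique.\<close>
  have "\<exists>S. minimiser p S \<and>
      card (G p S) + (n - p - card S choose 2) \<le> extremal_count k (p + (n - p - card S))"
    if "p \<le> n" for p
    using that
  proof (induction p)
    case 0
    obtain S where S: "minimiser 0 S" using ex_min by blast
    have N0: "N 0 T = {}" for T using N_sub[of 0 T] by auto
    \<comment> \<open>Without left vertices the excess is minus the cardinality, so \<open>S\<close>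
      is everything and both summands vanish.\<close>
    have "excess 0 S \<le> excess 0 {0<..n}" using S by (auto simp: minimiser_def)
    then have "n \<le> card S" by (simp add: excess_def N0)
    moreover have "G 0 S = {}" using E by (auto simp: G_def)
    ultimately show ?case using S by (intro exI[of _ S]) (simp add: numeral_2_eq_2)
  next
    case (Suc p)
    then obtain S where S: "minimiser p S" and
      IH: "card (G p S) + (n - p - card S choose 2) \<le> extremal_count k (p + (n - p - card S))"
      by auto
    obtain T where "minimiser (Suc p) T" using ex_min by blast
    define S' where "S' = T \<inter> S"
    have S': "minimiser (Suc p) S'" using min_Int S \<open>minimiser (Suc p) T\<close> by (simp add: S'_def)
    have sub: "S' \<subseteq> S" "S' \<subseteq> {Suc p<..n}" "S \<subseteq> {p<..n}"
      using S S' by (auto simp: minimiser_def S'_def)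
    then have fin: "finite S" "finite S'" by (auto intro: finite_subset)
    define w w' d c where "w = n - p - card S" and "w' = n - Suc p - card S'"
      and "d = card (S - S')" and "c = card (N p S)"
    have "card S \<le> n - p" "card S' \<le> n - Suc p"
      using card_mono[OF _ sub(2)] card_mono[OF _ sub(3)] by auto
    moreover have "card S = card S' + d"
      using fin sub by (simp add: d_def card_Diff_subset card_mono)
    \<comment> \<open>Vertex \<open>p + 1\<close> leaves the right side while \<open>d\<close>
      vertices leave \<open>S\<close>.\<close>
    ultimately have w': "w' + 1 = w + d" using Suc.prems unfolding w_def w'_def by linarith
    have cw: "c + w < k" using min_less[OF _ S] Suc.prems by (simp add: c_def w_def)
    have "w' < k" using min_less[OF Suc.prems S'] by (simp add: w'_def)
    then have "d \<le> k" using w' by linarith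
    \<comment> \<open>A newly counted edge either has its right end leaving \<open>S\<close>, so its
      left end is in \<open>N p S\<close>, or starts at \<open>p + 1\<close>.\<close>
    have "G (Suc p) S' \<subseteq> G p S \<union> N p S \<times> (S - S') \<union> {Suc p} \<times> ({Suc p<..n} - S')"
      using E by (auto simp: G_def N_def le_Suc_eq)
    then have "card (G (Suc p) S') \<le> card (G p S \<union> N p S \<times> (S - S') \<union> {Suc p} \<times> ({Suc p<..n} - S'))"
      by (rule card_mono[rotated]) (use finE finN fin in \<open>auto simp: G_def\<close>)
    also have "\<dots> \<le> card (G p S) + card (N p S \<times> (S - S')) + card ({Suc p} \<times> ({Suc p<..n} - S'))"
      by (meson add_le_mono1 card_Un_le order_trans)
    also have "\<dots> = card (G p S) + c * d + w'"
      using fin sub(2) by (simp add: card_cartesian_product c_def d_def w'_def card_Diff_subset)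
    finally have G': "card (G (Suc p) S') \<le> card (G p S) + c * d + w'" .
    \<comment> \<open>The \<open>w'\<close> edges at \<open>p + 1\<close> and the new clique
      allowance together make a clique on \<open>w + d\<close> vertices. Beyond the old allowance
      the step thus costs \<open>d * (c + w) + (d choose 2)\<close>, which the growth from
      \<open>p + w\<close> covers.\<close>
    have "(w' + 1 choose 2) = w' + (w' choose 2)" by (simp add: numeral_2_eq_2)
    then have eq: "w' + (w' choose 2) = (w choose 2) + d * w + (d choose 2)"
      using w' choose_two_add[of w d] by simp
    have "d * (c + w) + (d choose 2) \<le> (\<Sum>m=p + w..<p + w + d. extremal_degree k m)"
      by (rule extremal_count_increment) (use \<open>d \<le> k\<close> cw cardN[of p S] in \<open>auto simp: c_def\<close>)
    then have "extremal_count k (p + w) + d * (c + w) + (d choose 2) \<le> extremal_count k (p + w + d)"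
      by (simp add: extremal_count_add)
    moreover have "p + w + d = Suc p + w'" using w' by simp
    moreover have "d * (c + w) = c * d + d * w" by (simp add: algebra_simps)
    ultimately have "extremal_count k (p + w) + (c * d + d * w) + (d choose 2) \<le> extremal_count k (Suc p + w')"
      by (simp only:)
    then have "card (G (Suc p) S') + (w' choose 2) \<le> extremal_count k (Suc p + w')"
      using G' eq IH unfolding w_def[symmetric] by linarith
    then show ?case using S' unfolding w'_def by blast
  qed
  from this[of n] obtain S where S: "minimiser n S" "card (G n S) \<le> extremal_count k n"
    by (auto simp: numeral_2_eq_2)
  have "G n S = E" using S(1) E by (auto simp: G_def minimiser_def)
  then show ?thesis using S(2) by simp
qed

section \<open>From crossing matchings to forbidden ordered graphs\<close>

lemma card_2_less_obtain:
  fixes e :: "'a::linorder set"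
  assumes "card e = 2"
  obtains i j where "i < j" "e = {i, j}"
proof -
  obtain i j where "e = {i, j}" "i \<noteq> j" using assms by (auto simp: card_2_iff)
  then show ?thesis using that by (metis insert_commute linorder_neqE)
qed

lemma inj_on_doubleton: "inj_on (\<lambda>(i, j). {i, j}) {(i, j). i < (j::'a::linorder)}"
  by (auto simp: inj_on_def doubleton_eq_iff)

text \<open>All edge intervals contain \<open>p\<close>, so none are separated. The family lives on
  integers: the matching is transported by \<open>int\<close> and embedded back by
  \<open>nat\<close>.\<close>

lemma contains_copy_if_crossing_matching:
  fixes M :: "(nat \<times> nat) set"
  assumes fin: "finite M" and inj: "inj_on fst M" "inj_on snd M"
    and cross: "\<And>i j. (i, j) \<in> M \<Longrightarrow> i \<le> p \<and> p < j"
    and edge: "\<And>i j. (i, j) \<in> M \<Longrightarrow> {i, j} \<in> E \<and> {i, j} \<subseteq> V"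
  shows "\<exists>H\<in>non_sep_matchings (card M). contains_copy (V, E) H"
proof -
  define M' where "M' = (\<lambda>(i, j). {int i, int j}) ` M"
  have injM: "inj_on (\<lambda>(i, j). {int i, int j}) M"
  proof (rule inj_onI)
    fix x y assume xy: "x \<in> M" "y \<in> M"
      "(case x of (i, j) \<Rightarrow> {int i, int j}) = (case y of (i, j) \<Rightarrow> {int i, int j})"
    obtain i j i' j' where "x = (i, j)" "y = (i', j')" by fastforce
    with xy cross[of i j] cross[of i' j'] show "x = y" by (auto simp: doubleton_eq_iff)
  qed
  have "pairwise disjnt M'"
  proof (rule pairwiseI)
    fix e e' assume "e \<in> M'" "e' \<in> M'" "e \<noteq> e'"
    then obtain i j i' j' where *: "e = {int i, int j}" "e' = {int i', int j'}"
      "(i, j) \<in> M" "(i', j') \<in> M" "(i, j) \<noteq> (i', j')" by (auto simp: M'_def)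
    have "i \<noteq> i'" using inj_onD[OF inj(1) _ *(3,4)] *(5) by (metis fst_conv)
    moreover have "j \<noteq> j'" using inj_onD[OF inj(2) _ *(3,4)] *(5) by (metis snd_conv)
    moreover have "i \<noteq> j'" "j \<noteq> i'" using cross[OF *(3)] cross[OF *(4)] by linarith+
    ultimately show "disjnt e e'" unfolding *(1,2) by (simp add: disjnt_def)
  qed
  moreover have "card e = 2" if "e \<in> M'" for e
    using that by (auto simp: M'_def dest!: cross)
  ultimately have "k_matching (card M) M'"
    unfolding k_matching_def using fin card_image[OF injM] by (simp add: M'_def)
  moreover have "pairwise (\<lambda>e e'. \<not> separated e e') M'"
  proof (rule pairwiseI)
    have "int p \<in> {Min e..Max e}" if "e \<in> M'" for e
      using that by (auto simp: M'_def dest!: cross)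
    then show "\<not> separated e e'" if "e \<in> M'" "e' \<in> M'" for e e'
      using that unfolding separated_def by blast
  qed
  ultimately have "(\<Union>M', M') \<in> non_sep_matchings (card M)" by (auto simp: non_sep_matchings_def)
  moreover have "contains_copy (V, E) (\<Union>M', M')"
    unfolding contains_copy_def fst_conv snd_conv
  proof (intro exI[of _ nat] conjI ballI)
    show "nat ` \<Union>M' \<subseteq> V" using edge by (auto simp: M'_def)
    show "strict_mono_on (\<Union>M') nat" by (rule strict_mono_onI) (auto simp: M'_def)
    show "nat ` e \<in> E" if "e \<in> M'" for e using that edge by (auto simp: M'_def)
  qed
  ultimately show ?thesis by blast
qed

text \<open>A gap without a cover smaller than \<open>k\<close> would yield, by Koenig, a forbidden
  \<open>k\<close>-matching across it.\<close>

lemma card_edges_le: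
  assumes G: "ordered_graph ({1..n}, E)"
    and free: "\<forall>H\<in>non_sep_matchings k. \<not> contains_copy ({1..n}, E) H"
  shows "card E \<le> extremal_count k n"
proof -
  define E' where "E' = {(i::nat, j). i < j \<and> {i, j} \<in> E}"
  have sub: "e \<subseteq> {1..n}" "card e = 2" if "e \<in> E" for e
    using G that by (auto simp: ordered_graph_def)
  have E'sub: "E' \<subseteq> {(i, j). 1 \<le> i \<and> i < j \<and> j \<le> n}"
    using sub(1) by (fastforce simp: E'_def)
  have finE': "finite E'" by (rule finite_subset[of _ "{..n} \<times> {..n}"]) (use E'sub in auto)
  have "E = (\<lambda>(i, j). {i, j}) ` E'"
  proof
    show "E \<subseteq> (\<lambda>(i, j). {i, j}) ` E'"
    proof
      fix e assume e: "e \<in> E"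
      then obtain i j where "i < j" "e = {i, j}" using sub(2) card_2_less_obtain by metis
      then show "e \<in> (\<lambda>(i, j). {i, j}) ` E'" using e by (force simp: E'_def)
    qed
  qed (auto simp: E'_def)
  moreover have "inj_on (\<lambda>(i, j). {i, j}) E'"
    by (rule inj_on_subset[OF inj_on_doubleton]) (auto simp: E'_def)
  ultimately have "card E = card E'" by (metis card_image)
  moreover have "card E' \<le> extremal_count k n"
  proof (rule card_le_extremal_count_if_crossing_covers[OF E'sub])
    fix p assume "p \<le> n"
    show "\<exists>X Y. finite X \<and> finite Y \<and>
      {(i, j) \<in> E'. i \<le> p \<and> p < j} \<subseteq> X \<times> UNIV \<union> UNIV \<times> Y \<and> card X + card Y < k"
    proof (rule ccontr)
      assume "\<not> ?thesis"
      then have *: "k \<le> card X + card Y" if "finite X" "finite Y"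
        "{(i, j) \<in> E'. i \<le> p \<and> p < j} \<subseteq> X \<times> UNIV \<union> UNIV \<times> Y" for X Y
        using that by (meson not_le)
      have "finite {(i, j) \<in> E'. i \<le> p \<and> p < j}" by (rule finite_subset[OF _ finE']) auto
      from konig_matching_if_covers_large[OF this *] obtain M where M: "M \<subseteq> {(i, j) \<in> E'. i \<le> p \<and> p < j}"
        "card M = k" "inj_on fst M" "inj_on snd M" by blast
      have "finite M" using M(1) finE' by (rule_tac finite_subset[of _ E']) auto
      then have "\<exists>H\<in>non_sep_matchings (card M). contains_copy ({1..n}, E) H"
      proof (rule contains_copy_if_crossing_matching[OF _ M(3,4)])
        show "i \<le> p \<and> p < j" if "(i, j) \<in> M" for i j using that M(1) by auto
        show "{i, j} \<in> E \<and> {i, j} \<subseteq> {1..n}" if "(i, j) \<in> M" for i j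
          using that M(1) sub(1)[of "{i, j}"] by (auto simp: E'_def)
      qed
      then show False using free M(2) by simp
    qed
  qed
  ultimately show ?thesis by simp
qed

section \<open>The extremal construction\<close>

text \<open>For \<open>j < k\<close> the truncated subtraction gives the bound 0, which excludes only the non-vertex 0.\<close>

definition extremal_edges :: "nat \<Rightarrow> nat \<Rightarrow> nat set set" where
  "extremal_edges k n = {{i, j} |i j. k * (j div k - 1) < i \<and> i < j \<and> j \<le> n}"

text \<open>Edges are grouped by their larger end \<open>m + 1\<close>; dividing it by
  \<open>k\<close> with remainder gives the degree.\<close>

lemma card_extremal_edges:
  assumes "1 \<le> k"
  shows "card (extremal_edges k n) = extremal_count k n"
proof -
  let ?P = "SIGMA m:{..<n}. {k * (Suc m div k - 1)<..m}"
  have deg: "m - k * (Suc m div k - 1) = extremal_degree k m" for m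
  proof (cases "m < k - 1")
    case True
    then show ?thesis by (simp add: extremal_degree_def)
  next
    case False
    then have "1 \<le> Suc m div k" using assms by (simp add: Suc_le_eq div_greater_zero_iff)
    moreover have "k * (Suc m div k) + Suc m mod k = Suc m" by simp
    ultimately have "k * (Suc m div k - 1) + k + Suc m mod k = Suc m"
      by (simp add: diff_mult_distrib2)
    then show ?thesis using False assms by (simp add: extremal_degree_def)
  qed
  have "extremal_edges k n = (\<lambda>(m, i). {i, Suc m}) ` ?P"
  proof
    show "extremal_edges k n \<subseteq> (\<lambda>(m, i). {i, Suc m}) ` ?P"
    proof
      fix e assume "e \<in> extremal_edges k n"
      then obtain i j where "e = {i, j}" "k * (j div k - 1) < i" "i < j" "j \<le> n"
        by (auto simp: extremal_edges_def)
      then show "e \<in> (\<lambda>(m, i). {i, Suc m}) ` ?P"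
        by (intro image_eqI[of _ _ "(j - 1, i)"]) auto
    qed
    show "(\<lambda>(m, i). {i, Suc m}) ` ?P \<subseteq> extremal_edges k n"
      by (fastforce simp: extremal_edges_def)
  qed
  moreover have "inj_on (\<lambda>(m, i). {i, Suc m}) ?P"
    by (auto simp: inj_on_def doubleton_eq_iff)
  ultimately have "card (extremal_edges k n) = card ?P" by (simp add: card_image)
  also have "\<dots> = extremal_count k n"
    by (simp only: card_SigmaI finite_lessThan finite_greaterThanAtMost card_greaterThanAtMost
        deg extremal_count_def simp_thms ball_triv)
  finally show ?thesis .
qed

text \<open>With \<open>t = p div k\<close>, a right end below \<open>(t + 1) * k\<close> lies in
  \<open>C\<close> itself. A larger one has quotient at least \<open>t + 1\<close>, which forces the
  left end above \<open>t * k\<close> and hence into \<open>C\<close>.\<close>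

lemma extremal_edges_crossing_cover:
  assumes "1 \<le> k"
  shows "\<exists>C. finite C \<and> card C < k \<and>
    (\<forall>i j. k * (j div k - 1) < i \<longrightarrow> i \<le> p \<longrightarrow> p < j \<longrightarrow> i \<in> C \<or> j \<in> C)"
proof -
  define t where "t = p div k"
  have p: "p = t * k + p mod k" "p mod k < k" using assms by (auto simp: t_def)
  let ?C = "{t * k<..p} \<union> {p<..<t * k + k}"
  have "?C = {t * k<..<t * k + k}" using p by auto
  then have "card ?C < k" using assms by simp
  moreover have "i \<in> ?C \<or> j \<in> ?C" if "k * (j div k - 1) < i" "i \<le> p" "p < j" for i j
  proof (cases "j < t * k + k")
    case False
    then have "(t + 1) * k div k \<le> j div k" by (intro div_le_mono) simp
    then have "t + 1 \<le> j div k" using assms by simp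
    then have "k * t \<le> k * (j div k - 1)" by (intro mult_le_mono) auto
    then have "k * t < i" using that(1) by (rule le_less_trans)
    then show ?thesis using that by (simp add: mult.commute)
  qed (use that in simp)
  ultimately show ?thesis by (intro exI[of _ ?C]) auto
qed

text \<open>One-dimensional Helly: the largest left end lies in every interval, and disjointness of
  the edges makes the right inequality strict. That \<open>x\<close> is a vertex lets
  order-preserving maps of the matching be applied to it.\<close>

lemma non_sep_matching_common_gap:
  fixes M :: "'a::linorder set set"
  assumes M: "k_matching k M" "pairwise (\<lambda>e e'. \<not> separated e e') M" and "1 \<le> k"
  obtains x where "x \<in> \<Union>M" "\<And>e. e \<in> M \<Longrightarrow> Min e \<le> x \<and> x < Max e"
proof -
  have fin: "finite M" "M \<noteq> {}" using M(1) \<open>1 \<le> k\<close> by (auto simp: k_matching_def)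
  have e2: "finite e" "Min e \<in> e" "Max e \<in> e" "Min e < Max e" if "e \<in> M" for e
  proof -
    have "card e = 2" using M(1) that by (auto simp: k_matching_def)
    then obtain i j where "i < j" "e = {i, j}" by (rule card_2_less_obtain)
    then show "finite e" "Min e \<in> e" "Max e \<in> e" "Min e < Max e" by (auto simp: min_def max_def)
  qed
  have "Max (Min ` M) \<in> Min ` M" using fin by simp
  then obtain e0 where e0: "e0 \<in> M" "Min e0 = Max (Min ` M)" by auto
  have "Min e \<le> Min e0 \<and> Min e0 < Max e" if e: "e \<in> M" for e
  proof (cases "e = e0")
    case True
    then show ?thesis using e2 e by simp
  next
    case False
    have "Min e \<le> Min e0" using e0 e fin by simp
    moreover have "\<not> separated e e0" using M(2) e e0(1) False by (auto simp: pairwise_def)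
    then have "Min e0 \<le> Max e" by (auto simp: separated_def)
    moreover have "disjnt e e0" using M(1) e e0(1) False by (auto simp: k_matching_def pairwise_def)
    then have "Min e0 \<noteq> Max e" using e2[OF e] e2[OF e0(1)] by (metis disjnt_iff)
    ultimately show ?thesis by simp
  qed
  then show ?thesis using that e2(2)[OF e0(1)] e0(1) by blast
qed

text \<open>A copy sends all \<open>k\<close> edges across the gap after \<open>f x\<close>. Each
  meets the cover \<open>C\<close>, disjoint edges in different vertices, but \<open>C\<close> has
  fewer than \<open>k\<close>.\<close>

lemma extremal_edges_free:
  assumes "1 \<le> k" and H: "H \<in> non_sep_matchings k"
  shows "\<not> contains_copy ({1..n}, extremal_edges k n) H"
proof
  assume "contains_copy ({1..n}, extremal_edges k n) H"
  moreover obtain M where M: "H = (\<Union>M, M)" "k_matching k M" "pairwise (\<lambda>e e'. \<not> separated e e') M"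
    using H by (auto simp: non_sep_matchings_def)
  ultimately obtain f where f: "strict_mono_on (\<Union>M) f" "\<And>e. e \<in> M \<Longrightarrow> f ` e \<in> extremal_edges k n"
    by (auto simp: contains_copy_def)
  obtain x where x: "x \<in> \<Union>M" "\<And>e. e \<in> M \<Longrightarrow> Min e \<le> x \<and> x < Max e"
    using non_sep_matching_common_gap[OF M(2,3) assms(1)] by metis
  obtain C where C: "finite C" "card C < k"
    "\<And>i j. k * (j div k - 1) < i \<Longrightarrow> i \<le> f x \<Longrightarrow> f x < j \<Longrightarrow> i \<in> C \<or> j \<in> C"
    using extremal_edges_crossing_cover[OF assms(1), of "f x"] by metis
  have hit: "\<exists>v\<in>e. f v \<in> C" if e: "e \<in> M" for e
  proof -
    have "card e = 2" using M(2) e by (auto simp: k_matching_def)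
    then obtain a b where ab: "a < b" "e = {a, b}" by (rule card_2_less_obtain)
    then have "a \<le> x" "x < b" using x(2)[OF e] by (auto simp: min_def max_def)
    moreover have "a \<in> \<Union>M" "b \<in> \<Union>M" using ab e by auto
    ultimately have "f a \<le> f x" "f x < f b"
      using f(1) x(1) by (metis le_less strict_mono_onD)+
    moreover obtain i j where "{f a, f b} = {i, j}" "i < j" "k * (j div k - 1) < i"
      using f(2)[OF e] ab by (auto simp: extremal_edges_def)
    ultimately have "k * (f b div k - 1) < f a" by (auto simp: doubleton_eq_iff)
    then show ?thesis using C(3) \<open>f a \<le> f x\<close> \<open>f x < f b\<close> ab by blast
  qed
  then obtain g where g: "\<And>e. e \<in> M \<Longrightarrow> g e \<in> e \<and> f (g e) \<in> C" by metis
  have "inj_on (\<lambda>e. f (g e)) M"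
  proof (rule inj_onI)
    fix e e' assume e: "e \<in> M" "e' \<in> M" "f (g e) = f (g e')"
    have "g e = g e'"
      using strict_mono_on_imp_inj_on[OF f(1)] e g by (meson UnionI inj_onD)
    then have "\<not> disjnt e e'" using g e by (metis disjnt_iff)
    then show "e = e'" using M(2) e by (auto simp: k_matching_def pairwise_def)
  qed
  then have "card M \<le> card C" by (rule card_inj_on_le) (use g C in auto)
  then show False using C(2) M(2) by (simp add: k_matching_def)
qed

lemma ordered_graph_extremal_edges: "ordered_graph ({1..n}, extremal_edges k n)"
  by (auto simp: ordered_graph_def extremal_edges_def)

theorem theorem2p1:
  fixes n k :: nat
  assumes "1 \<le> k" and "k \<le> n"
  shows "int (ex_ord n (non_sep_matchings k)) =
    \<lceil>(real n - 2 * real k + 1) / real k\<rceil>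
        * (int ((2 * k - 1) choose 2) - int ((k - 1) choose 2))
      + int ((2 * k - 1 - nat ((- (int n + 1)) mod int k)) choose 2)"
proof -
  have "ex_ord n (non_sep_matchings k) = extremal_count k n"
    unfolding ex_ord_def
  proof (rule Max_eqI)
    show "finite {card E |E. ordered_graph ({1..n}, E) \<and>
        (\<forall>H\<in>non_sep_matchings k. \<not> contains_copy ({1..n}, E) H)}"
      by (rule finite_subset[of _ "{..extremal_count k n}"]) (use card_edges_le in auto)
    show "extremal_count k n \<in> {card E |E. ordered_graph ({1..n}, E) \<and>
        (\<forall>H\<in>non_sep_matchings k. \<not> contains_copy ({1..n}, E) H)}"
      using ordered_graph_extremal_edges extremal_edges_free[OF assms(1)]
        card_extremal_edges[OF assms(1), of n, symmetric] by blast
  qed (use card_edges_le in auto)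
  then show ?thesis using extremal_count_closed_form[OF assms] by simp
qed

end
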